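(* Let $n\ge1$ and let $\Gamma$ be the complete bioriented graph with loops on the vertex set $[n]=\{1,\dots,n\}$ (so its set of oriented edges is $[n]\times[n]$). For $k\ge1$ let $\left\{{\Gamma\atop k}\right\}$ be the number of partitions of $[n]\times[n]$ into exactly $k$ nonempty parts induced by transitive maps $[n]\times[n]\to\{1,\dots,k\}$. Then $$\left\{{\Gamma\atop k}\right\}=\begin{cases}2\left\{{n\atop k}\right\},&k\ge3,\\ \tfrac12B_n-1,&k=2,\end{cases}$$ where $\left\{{n\atop k}\right\}$ is the Stirling number of the second kind and $B_n:=\sum_{1\le k\le n}\left\{{n\atop k}\right\}2^kk!$ is the number of transitive relations $\mathscr R$ on $[n]$ such that $([n]\times[n])\setminus\mathscr R$ is also transitive.
   Context: A map $\mathbf c:[n]\times[n]\to C$ to a set $C$ is transitive if $\mathbf c(i,k)\in\{\mathbf c(i,j),\mathbf c(j,k)\}$ for all $i,j,k\in[n]$ (not necessarily distinct). The partition induced by $\mathbf c$ is the partition of $[n]\times[n]$ into the nonempty fibers of $\mathbf c$. A relation $\mathscr R\subset[n]\times[n]$ is transitive if $(i,j),(j,k)\in\mathscr R$ implies $(i,k)\in\mathscr R$. *)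

theory Defs
  imports
    Complex_Main
    "HOL-Library.FuncSet"
    "HOL-Library.Disjoint_Sets"
    "HOL-Combinatorics.Stirling"
begin

text \<open>
  The complete bioriented graph with loops on \<open>{1..n}\<close> is given by its set of oriented edges.
\<close>

definition complete_edges :: "nat \<Rightarrow> (nat \<times> nat) set" where
  "complete_edges n = {1..n} \<times> {1..n}"

definition transitive_map :: "nat \<Rightarrow> (nat \<times> nat \<Rightarrow> 'c) \<Rightarrow> bool" where
  "transitive_map n c \<longleftrightarrow>
     (\<forall>i\<in>{1..n}. \<forall>j\<in>{1..n}. \<forall>k\<in>{1..n}. c (i, k) \<in> {c (i, j), c (j, k)})"

text \<open>
  The partition of \<open>A\<close> into the fibers of \<open>c\<close>. Only values attained on \<open>A\<close>
  contribute, so that all fibers are nonempty.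
\<close>

definition induced_partition :: "'a set \<Rightarrow> ('a \<Rightarrow> 'c) \<Rightarrow> 'a set set" where
  "induced_partition A c = (\<lambda>t. {a \<in> A. c a = t}) ` (c ` A)"

definition graph_Stirling :: "nat \<Rightarrow> nat \<Rightarrow> nat" where
  "graph_Stirling n k =
     card {P. partition_on (complete_edges n) P \<and> card P = k \<and>
              (\<exists>c \<in> complete_edges n \<rightarrow> {1..k}.
                 transitive_map n c \<and> P = induced_partition (complete_edges n) c)}"

definition B :: "nat \<Rightarrow> nat" where
  "B n = (\<Sum>k = 1..n. Stirling n k * 2 ^ k * fact k)"

end

theory Submission
  imports Defs "HOL-Library.Infinite_Set"
begin

text \<open>
  A transitive map \<open>c\<close> with at least three colours attains every colour on the diagonal, and
  \<open>c (i, j)\<close> is either always \<open>c (i, i)\<close> or always \<open>c (j, j)\<close>: for vertices with three distinct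
  diagonal colours, transitivity forces the same choice on every pair, and every further pair is
  compared with such a triple. So the induced partitions are the pullbacks of the partitions of
  \<open>{1..n}\<close> along the two projections. With two colours, an induced partition is a pair
  \<open>{R, E - R}\<close> of nonempty complementary transitive relations. Such \<open>R\<close> are linear orders of
  blocks, where each block is either full or empty in \<open>R\<close>; they correspond to a surjection onto
  \<open>{..<k}\<close> together with a Boolean for each of the \<open>k\<close> blocks.
\<close>

section \<open>Surjections and Stirling numbers\<close>

text \<open>Extensionality makes a surjection determined by its values on \<open>A\<close>, so that
  counting these functions is meaningful.\<close>

definition surjections :: "'a set \<Rightarrow> 'b set \<Rightarrow> ('a \<Rightarrow> 'b) set" where
  "surjections A T = {f \<in> A \<rightarrow>\<^sub>E T. f ` A = T}"

text \<open>The value \<open>t\<close> at the new point is either taken on \<open>A\<close> as well,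
  which leaves a surjection onto \<open>T\<close>, or taken only there, which leaves one onto
  \<open>T - {t}\<close>. These are the two terms of the Stirling recurrence.\<close>

lemma surjections_insert:
  assumes "a \<notin> A"
  shows "surjections (insert a A) T =
    (\<lambda>(t, f). f(a := t)) ` (SIGMA t:T. surjections A T \<union> surjections A (T - {t}))"
    (is "?L = ?R")
proof
  show "?L \<subseteq> ?R"
  proof
    fix f assume "f \<in> ?L"
    then have f: "f \<in> insert a A \<rightarrow>\<^sub>E T" "insert (f a) (f ` A) = T"
      by (auto simp: surjections_def)
    define g where "g = f(a := undefined)"
    have im: "g ` A = f ` A" using assms by (auto simp: g_def)
    have "g \<in> extensional A" using f(1) by (auto simp: g_def PiE_def extensional_def)
    then have "g \<in> surjections A (f ` A)" by (auto simp: surjections_def PiE_def im[symmetric])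
    moreover have "f ` A = T \<or> f ` A = T - {f a}" by (metis f(2) Diff_insert_absorb insert_absorb)
    ultimately have "(f a, g) \<in> (SIGMA t:T. surjections A T \<union> surjections A (T - {t}))"
      using PiE_mem[OF f(1) insertI1] by (metis (no_types, lifting) SigmaI UnI1 UnI2)
    moreover have "f = (\<lambda>(t, f). f(a := t)) (f a, g)" by (simp add: g_def)
    ultimately show "f \<in> ?R" by (rule rev_image_eqI)
  qed
  show "?R \<subseteq> ?L"
  proof
    fix h assume "h \<in> ?R"
    then obtain t f where h: "h = f(a := t)" "t \<in> T"
      and f: "f \<in> surjections A T \<union> surjections A (T - {t})" by auto
    have "h \<in> extensional (insert a A)"
      using f by (auto simp: h surjections_def PiE_def extensional_def)
    moreover have "h ` A = f ` A" using assms by (auto simp: h(1))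
    then have "h ` insert a A = insert (h a) (f ` A)" by (simp only: image_insert)
    then have "h ` insert a A = T" using f h by (auto simp: surjections_def)
    ultimately show "h \<in> ?L" unfolding surjections_def PiE_def by blast
  qed
qed

lemma finite_surjections: "finite A \<Longrightarrow> finite T \<Longrightarrow> finite (surjections A T)"
  unfolding surjections_def by (rule finite_subset[of _ "A \<rightarrow>\<^sub>E T"]) (auto intro: finite_PiE)

text \<open>The two kinds of restriction have different images, so each \<open>t\<close> contributes
  the sum of their counts. Summed over \<open>T\<close>, this is the Stirling recurrence scaled by
  \<open>fact (card T)\<close>.\<close>

lemma card_surjections:
  fixes A :: "'a set"
  assumes "finite A" "finite T"
  shows "card (surjections A T) = fact (card T) * Stirling (card A) (card T)"
  using assms
proof (induction A arbitrary: T rule: finite_induct)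
  case empty
  have "surjections {} T = (if T = {} then {\<lambda>_ :: 'a. undefined} else {})"
    by (auto simp: surjections_def)
  with empty show ?case by (cases "card T") auto
next
  case (insert a A)
  have inj: "inj_on (\<lambda>(t, f). f(a := t)) (SIGMA t:T. surjections A T \<union> surjections A (T - {t}))"
  proof (rule inj_onI, clarify)
    fix t f t' f'
    assume *: "f \<in> surjections A T \<union> surjections A (T - {t})"
      "f' \<in> surjections A T \<union> surjections A (T - {t'})" "f(a := t) = f'(a := t')"
    \<comment> \<open>Both functions are extensional on \<open>A\<close>, so resetting the updated
      function to \<open>undefined\<close> at \<open>a\<close> recovers them.\<close>
    from *(1,2) insert.hyps have "f a = undefined" "f' a = undefined"
      by (auto simp: surjections_def PiE_def extensional_def)
    with *(3) show "t = t' \<and> f = f'"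
      by (metis fun_upd_apply fun_upd_triv fun_upd_upd)
  qed
  have "card (surjections (insert a A) T) =
      (\<Sum>t\<in>T. card (surjections A T \<union> surjections A (T - {t})))"
    using insert.hyps insert.prems
    by (simp add: surjections_insert card_image[OF inj] finite_surjections)
  also have "\<dots> = (\<Sum>t\<in>T. card (surjections A T) + card (surjections A (T - {t})))"
    using insert.hyps insert.prems
    by (intro sum.cong refl card_Un_disjoint finite_surjections) (auto simp: surjections_def)
  also have "\<dots> = card T * (fact (card T) * Stirling (card A) (card T)
      + fact (card T - 1) * Stirling (card A) (card T - 1))"
    using insert.prems by (simp add: insert.IH)
  also have "\<dots> = fact (card T) * Stirling (card (insert a A)) (card T)"
    using insert.hyps by (cases "card T") (auto simp: algebra_simps)
  finally show ?case .
qed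

section \<open>Partitions into fibers and their number\<close>

lemma partition_on_induced_partition: "partition_on A (induced_partition A f)"
  by (rule partition_onI) (auto simp: induced_partition_def disjnt_def)

lemma card_induced_partition: "card (induced_partition A f) = card (f ` A)"
  unfolding induced_partition_def by (rule card_image) (auto simp: inj_on_def)

text \<open>With \<open>q\<close> sending a point to its block, \<open>f\<close> is constant on each
  block, and injectivity of \<open>g\<close> separates different blocks.\<close>

lemma induced_partition_comp:
  assumes Q: "partition_on A Q" and q: "\<And>x. x \<in> A \<Longrightarrow> q x \<in> Q \<and> x \<in> q x"
    and g: "inj_on g Q" and f: "\<And>x. x \<in> A \<Longrightarrow> f x = g (q x)"
  shows "induced_partition A f = Q" and "f ` A = g ` Q" and "q ` A = Q"
proof -
  have block: "q x = S" if "x \<in> S" "S \<in> Q" for x S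
    using Q q that by (metis partition_onD1 partition_onD2 disjointD UnionI disjoint_iff)
  show 1: "q ` A = Q"
  proof
    show "Q \<subseteq> q ` A"
    proof
      fix S assume S: "S \<in> Q"
      then obtain x where "x \<in> S" using Q by (metis partition_onD3 ex_in_conv)
      with S block Q show "S \<in> q ` A" by (metis partition_onD1 UnionI image_eqI)
    qed
  qed (use q in auto)
  then show 2: "f ` A = g ` Q" using f by (metis (no_types, lifting) image_cong image_image)
  have "{x \<in> A. f x = g S} = S" if S: "S \<in> Q" for S
  proof (intro set_eqI iffI)
    fix x assume "x \<in> {x \<in> A. f x = g S}"
    then have x: "x \<in> A" "g (q x) = g S" using f by auto
    then have "q x = S" using inj_onD[OF g] q S by blast
    with q x show "x \<in> S" by blast
  next
    fix x assume x: "x \<in> S"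
    then have "x \<in> A" using S partition_onD1[OF Q] by blast
    with f block[OF x S] show "x \<in> {x \<in> A. f x = g S}" by auto
  qed
  then have "(\<lambda>t. {x \<in> A. f x = t}) ` g ` Q = Q" by (auto simp: image_image)
  then show "induced_partition A f = Q" by (simp add: induced_partition_def 2)
qed

lemma partition_on_selector:
  assumes "partition_on A Q"
  obtains q where "\<And>x. x \<in> A \<Longrightarrow> q x \<in> Q \<and> x \<in> q x"
proof -
  have "\<forall>x\<in>A. \<exists>S. S \<in> Q \<and> x \<in> S" using partition_onD1[OF assms] by blast
  then show thesis using that by (metis (no_types, lifting) bchoice)
qed

text \<open>A surjection with fibers \<open>Q\<close> factors uniquely through the block map
  \<open>q\<close> as a surjection from \<open>Q\<close> onto \<open>T\<close>. Since the
  cardinalities agree, these factors are the bijections.\<close>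

lemma card_surjections_inducing:
  assumes "finite A" "partition_on A Q" "finite T" "card Q = card T"
  shows "card {f \<in> surjections A T. induced_partition A f = Q} = fact (card T)"
proof -
  obtain q where q: "\<And>x. x \<in> A \<Longrightarrow> q x \<in> Q \<and> x \<in> q x"
    using partition_on_selector[OF assms(2)] by blast
  have fin: "finite Q" using assms finite_elements by blast
  have inj: "inj_on g Q" if "g \<in> surjections Q T" for g
    using that fin assms(4) by (auto simp: surjections_def intro: eq_card_imp_inj_on)
  define F where "F = (\<lambda>g :: 'a set \<Rightarrow> 'b. restrict (g \<circ> q) A)"
  have qA: "q ` A = Q" using induced_partition_comp(3)[OF assms(2) q, of id q] by simp
  have "bij_betw F (surjections Q T) {f \<in> surjections A T. induced_partition A f = Q}"
    unfolding bij_betw_def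
  proof (intro conjI set_eqI iffI)
    show "inj_on F (surjections Q T)"
    proof (rule inj_onI)
      fix g h assume gh: "g \<in> surjections Q T" "h \<in> surjections Q T" "F g = F h"
      show "g = h"
      proof (rule extensionalityI[of _ Q])
        fix S assume "S \<in> Q"
        then obtain x where "x \<in> A" "S = q x" using qA by auto
        with fun_cong[OF gh(3), of x] show "g S = h S" by (simp add: F_def)
      qed (use gh in \<open>auto simp: surjections_def PiE_def\<close>)
    qed
  next
    fix f assume "f \<in> F ` surjections Q T"
    then obtain g where g: "g \<in> surjections Q T" "f = F g" by auto
    have f: "f x = g (q x)" if "x \<in> A" for x using that g by (simp add: F_def)
    have "induced_partition A f = Q" "f ` A = g ` Q"
      using induced_partition_comp[OF assms(2) q inj[OF g(1)] f] by auto
    with g q show "f \<in> {f \<in> surjections A T. induced_partition A f = Q}"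
      by (auto simp: surjections_def F_def)
  next
    fix f assume "f \<in> {f \<in> surjections A T. induced_partition A f = Q}"
    then have f: "f \<in> A \<rightarrow>\<^sub>E T" "f ` A = T" "induced_partition A f = Q"
      by (auto simp: surjections_def)
    \<comment> \<open>The choice of a representative does not matter: \<open>S\<close> is a fiber of
      \<open>f\<close>, so all its elements have the same value.\<close>
    define g where "g = restrict (\<lambda>S. f (SOME x. x \<in> S)) Q"
    have gq: "g (q x) = f x" if "x \<in> A" for x
    proof -
      have *: "q x \<in> Q" "x \<in> q x" using q that by auto
      then have "(SOME y. y \<in> q x) \<in> q x" by (metis someI)
      then show ?thesis using * f(3) by (auto simp: g_def induced_partition_def)
    qed
    have "g ` Q = T" using gq qA f(2) by (metis (no_types, lifting) image_cong image_image)
    then have "g \<in> surjections Q T" by (auto simp: surjections_def g_def)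
    moreover have "F g = f"
      using gq f(1) by (auto simp: F_def fun_eq_iff PiE_def extensional_def restrict_def)
    ultimately show "f \<in> F ` surjections Q T" by blast
  qed
  then have "card {f \<in> surjections A T. induced_partition A f = Q} = card (surjections Q T)"
    by (rule bij_betw_same_card[symmetric])
  also have "\<dots> = fact (card T)" using fin assms by (simp add: card_surjections)
  finally show ?thesis .
qed

text \<open>Double counting of the surjections onto \<open>{..<k}\<close>: grouped by their fibers,
  they form one class of size \<open>fact k\<close> for each partition into \<open>k\<close>
  blocks.\<close>

lemma card_partitions:
  assumes "finite A"
  shows "card {Q. partition_on A Q \<and> card Q = k} = Stirling (card A) k"
proof -
  define \<Q> where "\<Q> = {Q. partition_on A Q \<and> card Q = k}"
  have fin: "finite \<Q>" unfolding \<Q>_def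
    by (rule finite_subset[OF _ finitely_many_partition_on[OF assms]]) auto
  have "surjections A {..<k} = (\<Union>Q\<in>\<Q>. {f \<in> surjections A {..<k}. induced_partition A f = Q})"
    by (auto simp: \<Q>_def partition_on_induced_partition card_induced_partition surjections_def)
  then have "card (surjections A {..<k}) =
      card (\<Union>Q\<in>\<Q>. {f \<in> surjections A {..<k}. induced_partition A f = Q})" by simp
  also have "\<dots> = (\<Sum>Q\<in>\<Q>. card {f \<in> surjections A {..<k}. induced_partition A f = Q})"
    by (rule card_UN_disjoint) (auto simp: fin finite_surjections assms)
  also have "\<dots> = (\<Sum>Q\<in>\<Q>. fact k)"
    by (rule sum.cong) (auto simp: \<Q>_def card_surjections_inducing assms)
  finally have "fact k * Stirling (card A) k = fact k * card \<Q>"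
    by (simp add: card_surjections assms)
  then show ?thesis by (simp add: \<Q>_def)
qed

section \<open>Transitive maps with at least three colours\<close>

text \<open>Reversing all edges exchanges colouring by source with colouring by target, so an
  argument for one of them covers both.\<close>

lemma transitive_map_swap: "transitive_map n c \<Longrightarrow> transitive_map n (c \<circ> prod.swap)"
  unfolding transitive_map_def by fastforce

lemma transitive_map_diag:
  assumes "transitive_map n c" "i \<in> {1..n}" "j \<in> {1..n}"
  shows "c (i, i) = c (i, j) \<or> c (i, i) = c (j, i)"
  using assms unfolding transitive_map_def by blast

text \<open>A colour missing on the diagonal forces all loops to share one colour \<open>a\<close>.
  Then every edge of another colour has a reverse of colour \<open>a\<close>, which is incompatible
  with two further colours besides \<open>a\<close>.\<close>

lemma transitive_map_diag_colours:
  assumes tr: "transitive_map n c" and three: "card (c ` complete_edges n) \<ge> 3"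
  shows "c ` complete_edges n = (\<lambda>i. c (i, i)) ` {1..n}"
proof (rule ccontr)
  let ?V = "{1..n}"
  have t: "c (i, k) = c (i, j) \<or> c (i, k) = c (j, k)" if "i \<in> ?V" "j \<in> ?V" "k \<in> ?V" for i j k
    using tr that unfolding transitive_map_def by blast
  assume "c ` complete_edges n \<noteq> (\<lambda>i. c (i, i)) ` ?V"
  moreover have "(\<lambda>i. c (i, i)) ` ?V \<subseteq> c ` complete_edges n"
    unfolding complete_edges_def by auto
  ultimately obtain e where "e \<in> complete_edges n" "c e \<notin> (\<lambda>i. c (i, i)) ` ?V"
    by blast
  then obtain i j where ij: "i \<in> ?V" "j \<in> ?V" and x: "c (i, j) \<notin> (\<lambda>i. c (i, i)) ` ?V"
    unfolding complete_edges_def by (cases e) blast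
  define a where "a = c (i, i)"
  have ii: "c (i, i) = a" "c (j, j) = a" "c (j, i) = a" "c (i, j) \<noteq> a"
  proof -
    have "c (i, i) \<noteq> c (i, j)" "c (j, j) \<noteq> c (i, j)" using x ij unfolding image_iff by metis+
    then show "c (i, i) = a" "c (j, j) = a" "c (j, i) = a" "c (i, j) \<noteq> a"
      using t[OF ij(1) ij(2) ij(1)] t[OF ij(2) ij(1) ij(2)] unfolding a_def by metis+
  qed
  have diag: "c (k, k) = a" if "k \<in> ?V" for k
  proof (rule ccontr)
    assume ne: "c (k, k) \<noteq> a"
    \<comment> \<open>The colour \<open>c (i, j)\<close> recurs on \<open>(i, k)\<close> or on
      \<open>(k, j)\<close>. In the first case the distinct colours of the loops at \<open>i\<close>
      and \<open>k\<close> would both have to occur on \<open>(k, i)\<close>; the second case is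
      alike, with \<open>j\<close> and \<open>(j, k)\<close>.\<close>
    have "c (k, k) \<noteq> c (i, j)" using x that unfolding image_iff by metis
    with ne ii show False
      using t[OF ij(1) that ij(2)] t[OF ij(1) that ij(1)] t[OF that ij(1) that]
        t[OF ij(2) that ij(2)] t[OF that ij(2) that] by metis
  qed
  have "\<not> c ` complete_edges n \<subseteq> {a, c (i, j)}"
  proof
    assume "c ` complete_edges n \<subseteq> {a, c (i, j)}"
    then have "card (c ` complete_edges n) \<le> card {a, c (i, j)}" by (intro card_mono) auto
    also have "\<dots> \<le> 2" by (metis card_2_iff card.insert_remove card_insert_le_m1 ii(4) order_refl)
    finally show False using three by simp
  qed
  then obtain e' where "e' \<in> complete_edges n" "c e' \<noteq> a" "c e' \<noteq> c (i, j)"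
    by blast
  then obtain k l where kl: "k \<in> ?V" "l \<in> ?V" "c (k, l) \<noteq> a" "c (k, l) \<noteq> c (i, j)"
    unfolding complete_edges_def by (cases e') blast
  have anti: "c (q, p) = a" if "p \<in> ?V" "q \<in> ?V" "c (p, q) \<noteq> a" for p q
    using t[OF that(1) that(2) that(1)] diag[OF that(1)] that(3) by auto
  \<comment> \<open>In each case the edges among \<open>i\<close>, \<open>j\<close>,
    \<open>k\<close>, \<open>l\<close> are determined one by one until \<open>(i, l)\<close>,
    respectively \<open>(k, i)\<close>, has the third colour \<open>c (k, l)\<close>, while the path
    through \<open>j\<close> offers only \<open>c (i, j)\<close> and \<open>a\<close>.\<close>
  from t[OF ij(1) kl(1) ij(2)] show False
  proof
    assume "c (i, j) = c (i, k)"
    then have "c (k, i) = a" using anti[OF ij(1) kl(1)] ii by simp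
    then have il: "c (i, l) = c (k, l)" using t[OF kl(1) ij(1) kl(2)] kl by simp
    then have "c (l, j) = c (i, j)" using t[OF ij(1) kl(2) ij(2)] kl by simp
    then have "c (j, l) = a" using anti[OF kl(2) ij(2)] ii by simp
    then show False using t[OF ij kl(2)] il kl by simp
  next
    assume kj: "c (i, j) = c (k, j)"
    then have jl: "c (j, l) = c (k, l)" using t[OF kl(1) ij(2) kl(2)] kl by simp
    then have "c (l, j) = a" using anti[OF ij(2) kl(2)] kl by simp
    then have "c (i, l) = c (i, j)" using t[OF ij(1) kl(2) ij(2)] ii by simp
    then have "c (k, i) = c (k, l)" using t[OF kl(1) ij(1) kl(2)] kl by simp
    then show False using t[OF kl(1) ij(2) ij(1)] kj kl ii by simp
  qed
qed

text \<open>All colours occur on loops, so there are three vertices with distinct loop colours.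
  \<open>main\<close> spreads colouring by source from one edge of such a triple to all edges;
  reversal of edges covers colouring by target.\<close>

lemma transitive_map_cases:
  assumes tr: "transitive_map n c" and three: "card (c ` complete_edges n) \<ge> 3"
  shows "(\<forall>i\<in>{1..n}. \<forall>j\<in>{1..n}. c (i, j) = c (i, i)) \<or>
         (\<forall>i\<in>{1..n}. \<forall>j\<in>{1..n}. c (i, j) = c (j, j))"
proof -
  let ?V = "{1..n}"
  have main: "\<forall>p\<in>?V. \<forall>q\<in>?V. d (p, q) = d (p, p)"
    if tr: "transitive_map n d" and V: "i \<in> ?V" "j \<in> ?V" "k \<in> ?V"
      and ne: "d (i, i) \<noteq> d (j, j)" "d (i, i) \<noteq> d (k, k)" "d (j, j) \<noteq> d (k, k)"
      and ij: "d (i, j) = d (i, i)" for d :: "nat \<times> nat \<Rightarrow> 'a" and i j k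
  proof -
    have t: "d (i, k) = d (i, j) \<or> d (i, k) = d (j, k)" if "i \<in> ?V" "j \<in> ?V" "k \<in> ?V" for i j k
      using tr that unfolding transitive_map_def by blast
    define out where "out = (\<lambda>p q. d (p, q) = d (p, p) \<and> d (q, p) = d (q, q))"
    \<comment> \<open>The two distinct loop colours both occur on the two edges between
      \<open>p\<close> and \<open>q\<close>, so these edges carry them in one of two orders.\<close>
    have dich: "out p q \<or> d (p, q) = d (q, q) \<and> d (q, p) = d (p, p)"
      if "p \<in> ?V" "q \<in> ?V" "d (p, p) \<noteq> d (q, q)" for p q
      using t[of p q p] t[of q p q] t[of p p q] t[of q q p] that unfolding out_def by metis
    have sym: "out p q \<Longrightarrow> out q p" for p q unfolding out_def by auto
    \<comment> \<open>The loop colour of \<open>p\<close> on \<open>(p, q)\<close> recurs on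
      \<open>(p, r)\<close> or \<open>(r, q)\<close>, but by \<open>dich\<close> the edge
      \<open>(r, q)\<close> has the loop colour of \<open>r\<close> or \<open>q\<close>.\<close>
    have step: "out p r"
      if "out p q" "p \<in> ?V" "q \<in> ?V" "r \<in> ?V" "d (p, p) \<noteq> d (q, q)"
        "d (r, r) \<noteq> d (p, p)" "d (r, r) \<noteq> d (q, q)" for p q r
      using t[of p r q] dich[of p r] dich[of r q] that unfolding out_def by metis
    have "out i j" using dich[of i j] V ij ne unfolding out_def by metis
    then have "out i k" "out j k" "out j i" "out k i" "out k j"
      using step[of i j k] step[of j i k] sym V ne by metis+
    note tri = \<open>out i j\<close> this
    have outm: "out s m" if "m \<in> ?V" "s \<in> {i, j, k}" "d (m, m) \<noteq> d (s, s)" for m s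
    proof -
      \<comment> \<open>Of three distinct colours at least one differs from any two given ones; it
        serves as the intermediate colour for \<open>step\<close>.\<close>
      obtain u where "u \<in> {i, j, k}" "d (u, u) \<noteq> d (s, s)" "d (u, u) \<noteq> d (m, m)"
        using ne by (metis insertCI)
      then show ?thesis using step[of s u m] tri V that ne by auto
    qed
    have outpq: "out p q" if pq: "p \<in> ?V" "q \<in> ?V" "d (p, p) \<noteq> d (q, q)" for p q
    proof -
      obtain s where s: "s \<in> {i, j, k}" "d (s, s) \<noteq> d (p, p)" "d (s, s) \<noteq> d (q, q)"
        using ne by (metis insertCI)
      then have "s \<in> ?V" using V by auto
      have "out s p" using outm[of p s] pq s by auto
      then show ?thesis using step[of p s q] sym s pq \<open>s \<in> ?V\<close> by metis
    qed
    show ?thesis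
    proof (intro ballI)
      fix p q assume pq: "p \<in> ?V" "q \<in> ?V"
      show "d (p, q) = d (p, p)"
      proof (cases "d (p, p) = d (q, q)")
        case True
        \<comment> \<open>The path through \<open>r\<close> offers for \<open>(p, q)\<close> the
          loop colours of \<open>p\<close> and \<open>r\<close>, the path through \<open>s\<close>
          those of \<open>p\<close> and \<open>s\<close>; only that of \<open>p\<close> is common to
          both.\<close>
        obtain r s where rs: "r \<in> ?V" "s \<in> ?V" "d (r, r) \<noteq> d (s, s)" "d (r, r) \<noteq> d (p, p)"
          "d (s, s) \<noteq> d (p, p)"
          using ne V by metis
        then show ?thesis
          using outpq[of p r] outpq[of p s] outpq[of r q] outpq[of s q] t[of p r q] t[of p s q]
            True pq unfolding out_def by metis
      next
        case False
        then show ?thesis using outpq pq unfolding out_def by blast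
      qed
    qed
  qed
  have "card ((\<lambda>i. c (i, i)) ` ?V) \<ge> 3"
    using three transitive_map_diag_colours[OF tr three] by simp
  then obtain S where "S \<subseteq> (\<lambda>i. c (i, i)) ` ?V" "card S = 3"
    by (rule obtain_subset_with_card_n)
  then obtain i j k where V: "i \<in> ?V" "j \<in> ?V" "k \<in> ?V"
      and ne: "c (i, i) \<noteq> c (j, j)" "c (i, i) \<noteq> c (k, k)" "c (j, j) \<noteq> c (k, k)"
    by (auto simp: card_3_iff)
  from transitive_map_diag[OF tr V(1,2)] show ?thesis
  proof
    assume "c (i, i) = c (i, j)"
    from main[OF tr V ne this[symmetric]] show ?thesis by blast
  next
    assume "c (i, i) = c (j, i)"
    then have "\<forall>p\<in>?V. \<forall>q\<in>?V. (c \<circ> prod.swap) (p, q) = (c \<circ> prod.swap) (p, p)"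
      by (intro main[OF transitive_map_swap[OF tr] V]) (use ne in simp_all)
    then show ?thesis unfolding comp_apply swap_simp by blast
  qed
qed


section \<open>Induced partitions with at least three parts\<close>

text \<open>Numbering the blocks yields a colouring with the range that
  \<open>graph_Stirling\<close> asks for.\<close>

lemma partition_on_imp_induced:
  assumes "finite A" "partition_on A Q" "card Q = k"
  obtains f where "f \<in> A \<rightarrow> {1..k}" "induced_partition A f = Q"
proof -
  obtain q where q: "\<And>x. x \<in> A \<Longrightarrow> q x \<in> Q \<and> x \<in> q x"
    using partition_on_selector[OF assms(2)] by blast
  have "finite Q" using assms finite_elements by blast
  then obtain g where g: "bij_betw g Q {1..k}"
    using finite_same_card_bij[of Q "{1..k}"] assms by auto
  show thesis
  proof (rule that)
    show "g \<circ> q \<in> A \<rightarrow> {1..k}" using g q by (auto simp: bij_betw_def)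
    show "induced_partition A (g \<circ> q) = Q"
      using induced_partition_comp(1)[OF assms(2) q bij_betw_imp_inj_on[OF g]] by simp
  qed
qed

text \<open>A colouring by source has as fibers the cylinders over the fibers of \<open>f\<close>;
  nonemptiness of \<open>D\<close> makes every colour of \<open>f\<close> occur.\<close>

lemma induced_partition_fst:
  assumes "D \<noteq> {}" "\<And>x y. x \<in> A \<Longrightarrow> y \<in> D \<Longrightarrow> c (x, y) = f x"
  shows "induced_partition (A \<times> D) c = (\<lambda>S. S \<times> D) ` induced_partition A f"
proof -
  have "c ` (A \<times> D) = f ` A" using assms by (force simp: image_iff)
  moreover have "{a \<in> A \<times> D. c a = t} = {x \<in> A. f x = t} \<times> D" for t using assms by auto
  ultimately show ?thesis by (simp add: induced_partition_def image_image)
qed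

lemma induced_partition_snd:
  assumes "A \<noteq> {}" "\<And>x y. x \<in> A \<Longrightarrow> y \<in> D \<Longrightarrow> c (x, y) = f y"
  shows "induced_partition (A \<times> D) c = (\<lambda>S. A \<times> S) ` induced_partition D f"
proof -
  have "c ` (A \<times> D) = f ` D" using assms by (force simp: image_iff)
  moreover have "{a \<in> A \<times> D. c a = t} = A \<times> {y \<in> D. f y = t}" for t using assms by auto
  ultimately show ?thesis by (simp add: induced_partition_def image_image)
qed

text \<open>\<open>F\<close> and \<open>G\<close> pull partitions of the vertex set back along the
  two projections. Both are injective and their images are disjoint, which gives the factor
  two.\<close>

lemma graph_Stirling_ge_3:
  assumes "n \<ge> 1" "k \<ge> 3"
  shows "graph_Stirling n k = 2 * Stirling n k"
proof -
  let ?V = "{1..n}"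
  define \<Q> where "\<Q> = {Q. partition_on ?V Q \<and> card Q = k}"
  define F where "F = (\<lambda>Q :: nat set set. (\<lambda>S. S \<times> ?V) ` Q)"
  define G where "G = (\<lambda>Q :: nat set set. (\<lambda>S. ?V \<times> S) ` Q)"
  have V: "?V \<noteq> {}" "1 \<in> ?V" using assms by auto
  have injF: "inj (\<lambda>S :: nat set. S \<times> ?V)" and injG: "inj (\<lambda>S :: nat set. ?V \<times> S)"
    using V by (auto simp: inj_def)
  have "{P. partition_on (complete_edges n) P \<and> card P = k \<and>
      (\<exists>c \<in> complete_edges n \<rightarrow> {1..k}.
         transitive_map n c \<and> P = induced_partition (complete_edges n) c)} = F ` \<Q> \<union> G ` \<Q>"
    (is "?L = ?R")
  proof (intro set_eqI iffI)
    fix P assume "P \<in> ?L"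
    then obtain c :: "nat \<times> nat \<Rightarrow> nat"
      where c: "transitive_map n c" "P = induced_partition (complete_edges n) c"
      "card P = k" unfolding mem_Collect_eq by blast
    define f where "f = (\<lambda>i. c (i, i))"
    from c assms have "card (c ` complete_edges n) \<ge> 3" by (simp add: card_induced_partition)
    from transitive_map_cases[OF c(1) this] show "P \<in> ?R"
    proof
      assume *: "\<forall>i\<in>?V. \<forall>j\<in>?V. c (i, j) = c (i, i)"
      have P: "P = F (induced_partition ?V f)"
        unfolding c(2) F_def complete_edges_def
        by (rule induced_partition_fst[OF V(1)]) (unfold f_def, use * in blast)
      then have "card (induced_partition ?V f) = k"
        using c(3) card_image[OF inj_on_subset[OF injF subset_UNIV]] by (simp add: F_def)
      then have "induced_partition ?V f \<in> \<Q>" by (simp add: \<Q>_def partition_on_induced_partition)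
      with P show ?thesis by blast
    next
      assume *: "\<forall>i\<in>?V. \<forall>j\<in>?V. c (i, j) = c (j, j)"
      have P: "P = G (induced_partition ?V f)"
        unfolding c(2) G_def complete_edges_def
        by (rule induced_partition_snd[OF V(1)]) (unfold f_def, use * in blast)
      then have "card (induced_partition ?V f) = k"
        using c(3) card_image[OF inj_on_subset[OF injG subset_UNIV]] by (simp add: G_def)
      then have "induced_partition ?V f \<in> \<Q>" by (simp add: \<Q>_def partition_on_induced_partition)
      with P show ?thesis by blast
    qed
  next
    fix P assume "P \<in> ?R"
    then obtain Q where Q: "partition_on ?V Q" "card Q = k" "P = F Q \<or> P = G Q"
      by (auto simp: \<Q>_def)
    obtain f where f: "f \<in> ?V \<rightarrow> {1..k}" "induced_partition ?V f = Q"
      using partition_on_imp_induced[OF _ Q(1,2)] by auto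
    have card: "card (F Q) = k" "card (G Q) = k"
      using Q(2) card_image[OF inj_on_subset[OF injF subset_UNIV]]
        card_image[OF inj_on_subset[OF injG subset_UNIV]] by (simp_all add: F_def G_def)
    have "F Q = induced_partition (complete_edges n) (f \<circ> fst)"
      unfolding f(2)[symmetric] F_def complete_edges_def
      by (rule induced_partition_fst[OF V(1), symmetric]) simp
    moreover have "G Q = induced_partition (complete_edges n) (f \<circ> snd)"
      unfolding f(2)[symmetric] G_def complete_edges_def
      by (rule induced_partition_snd[OF V(1), symmetric]) simp
    moreover have "transitive_map n (f \<circ> fst)" "transitive_map n (f \<circ> snd)"
      "f \<circ> fst \<in> complete_edges n \<rightarrow> {1..k}" "f \<circ> snd \<in> complete_edges n \<rightarrow> {1..k}"
      using f(1) by (auto simp: transitive_map_def complete_edges_def)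
    ultimately show "P \<in> ?L"
      using Q(3) card partition_on_induced_partition[of "complete_edges n"]
      unfolding mem_Collect_eq by metis
  qed
  then have "graph_Stirling n k = card (F ` \<Q> \<union> G ` \<Q>)" by (simp add: graph_Stirling_def)
  also have "\<dots> = card (F ` \<Q>) + card (G ` \<Q>)"
  proof (rule card_Un_disjoint)
    have "finite \<Q>" unfolding \<Q>_def
      by (rule finite_subset[OF _ finitely_many_partition_on[of ?V]]) auto
    then show "finite (F ` \<Q>)" "finite (G ` \<Q>)" by auto
    show "F ` \<Q> \<inter> G ` \<Q> = {}"
    proof (rule ccontr)
      assume "F ` \<Q> \<inter> G ` \<Q> \<noteq> {}"
      then obtain Q Q' where Q: "Q \<in> \<Q>" "Q' \<in> \<Q>" "F Q = G Q'" by auto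
      \<comment> \<open>A part that is a cylinder in both directions is the whole square, so a
        common partition would have a single part, against \<open>k \<ge> 3\<close>.\<close>
      have "S = ?V" if "S \<in> Q" for S
      proof -
        have "S \<times> ?V \<in> G Q'" using that Q(3) by (auto simp: F_def)
        then obtain T where T: "S \<times> ?V = ?V \<times> T" by (auto simp: G_def)
        have "S \<noteq> {}" using that Q(1) partition_onD3 by (auto simp: \<Q>_def)
        with T V show ?thesis by (metis times_eq_iff Sigma_empty1 Sigma_empty2)
      qed
      then have "Q \<subseteq> {?V}" by auto
      then have "card Q \<le> 1" using card_mono[of "{?V}" Q] by simp
      with Q(1) assms show False by (simp add: \<Q>_def)
    qed
  qed
  also have "\<dots> = 2 * card \<Q>"
    using injF injG by (simp add: F_def G_def card_image inj_on_image inj_image_eq_iff inj_on_def)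
  also have "card \<Q> = Stirling n k" unfolding \<Q>_def by (simp add: card_partitions)
  finally show ?thesis .
qed

section \<open>Transitive relations with transitive complement\<close>

text \<open>Encodes a linear order of blocks: \<open>f\<close> gives the rank of a point, and
  \<open>g\<close> marks the ranks whose block is full. That every rank occurs is added later by
  taking \<open>f\<close> surjective.\<close>

definition layered_rel :: "'a set \<Rightarrow> ('a \<Rightarrow> nat) \<Rightarrow> (nat \<Rightarrow> bool) \<Rightarrow> ('a \<times> 'a) set" where
  "layered_rel A f g = {(i, j) \<in> A \<times> A. f i < f j \<or> f i = f j \<and> g (f i)}"

text \<open>The complement has the same form, with the order of ranks reversed and \<open>g\<close>
  negated.\<close>

lemma trans_layered_rel:
  "trans (layered_rel A f g)" "trans (A \<times> A - layered_rel A f g)"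
  by (auto simp: layered_rel_def trans_def)

text \<open>Ranks that fill an initial segment of the naturals are determined by the order they
  induce. Strong induction on the rank shows that \<open>f' x\<close> lies neither below nor above
  \<open>f x\<close>.\<close>

lemma surjections_lessThan_unique:
  fixes f f' :: "'a \<Rightarrow> nat"
  assumes f: "f \<in> surjections A {..<k}" and f': "f' \<in> surjections A {..<k'}"
    and iff: "\<And>x y. x \<in> A \<Longrightarrow> y \<in> A \<Longrightarrow> f x < f y \<longleftrightarrow> f' x < f' y"
  shows "k = k'" "f = f'"
proof -
  have eq: "f' x = m" if "x \<in> A" "f x = m" for x m
    using that
  proof (induction m arbitrary: x rule: less_induct)
    case (less m)
    have "\<not> f' x < m"
    proof
      assume lt: "f' x < m"
      moreover have "m < k" using f less.prems by (auto simp: surjections_def)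
      ultimately have "f' x \<in> f ` A" using f by (simp add: surjections_def)
      then obtain y where y: "y \<in> A" "f y = f' x" by force
      then have "f' y = f' x" using less.IH[OF lt] by simp
      with iff y less.prems lt show False by (metis less_irrefl)
    qed
    moreover have "\<not> m < f' x"
    proof
      assume lt: "m < f' x"
      moreover have "f' x < k'" using f' less.prems by (auto simp: surjections_def)
      ultimately have "m \<in> f' ` A" using f' by (simp add: surjections_def)
      then obtain y where y: "y \<in> A" "f' y = m" by force
      then have "f y < m" using iff[of y x] lt less.prems by simp
      with less.IH[OF this y(1)] y show False by simp
    qed
    ultimately show ?case by simp
  qed
  have "f ` A = {..<k}" "f' ` A = {..<k'}" using f f' by (auto simp: surjections_def)
  moreover have "f ` A = f' ` A" using eq by auto
  ultimately show "k = k'" by (metis card_lessThan)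
  show "f = f'"
    by (rule extensionalityI[of _ A]) (use f f' eq in \<open>auto simp: surjections_def PiE_def\<close>)
qed

text \<open>Replacing each value of \<open>h\<close> by its position in the increasing enumeration
  \<open>e\<close> of the attained values closes all gaps and keeps the order.\<close>

lemma surjections_lessThan_of_weak_order:
  fixes h :: "'a \<Rightarrow> nat"
  assumes "finite A"
  obtains k and f :: "'a \<Rightarrow> nat" where "f \<in> surjections A {..<k}"
    "\<And>x y. x \<in> A \<Longrightarrow> y \<in> A \<Longrightarrow> f x < f y \<longleftrightarrow> h x < h y"
proof -
  let ?k = "card (h ` A)"
  obtain e where e: "bij_betw e {..<?k} (h ` A)" "strict_mono_on {..<?k} e"
    using ex_bij_betw_strict_mono_card[of "h ` A"] assms by blast
  define f where "f = restrict (\<lambda>x. the_inv_into {..<?k} e (h x)) A"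
  have inj: "inj_on e {..<?k}" using e(1) by (simp add: bij_betw_def)
  have img: "e ` {..<?k} = h ` A" using e(1) by (simp add: bij_betw_def)
  have ef: "f x < ?k" "e (f x) = h x" if "x \<in> A" for x
    using the_inv_into_into[OF inj, of "h x" "{..<?k}"] f_the_inv_into_f[OF inj, of "h x"] that img
    by (auto simp: f_def)
  have "f ` A = {..<?k}"
  proof
    show "{..<?k} \<subseteq> f ` A"
    proof
      fix m assume m: "m \<in> {..<?k}"
      then obtain x where x: "x \<in> A" "e m = h x" using img by fastforce
      with ef[of x] m inj have "f x = m" by (auto simp: inj_on_def)
      with x show "m \<in> f ` A" by auto
    qed
  qed (use ef in auto)
  then have "f \<in> surjections A {..<?k}" by (auto simp: surjections_def f_def)
  moreover have "f x < f y \<longleftrightarrow> h x < h y" if "x \<in> A" "y \<in> A" for x y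
    using strict_mono_on_less[OF e(2), of "f x" "f y"] ef that by auto
  ultimately show thesis using that by blast
qed

text \<open>The asymmetric part \<open>lt\<close> of \<open>R\<close> is a strict weak order.
  Counting strict predecessors turns it into a rank, and on points of equal rank \<open>R\<close> is
  full or empty.\<close>

lemma layered_rel_exists:
  fixes R :: "('a \<times> 'a) set"
  assumes fin: "finite A" and R: "R \<subseteq> A \<times> A" "trans R" "trans (A \<times> A - R)"
  obtains f k g where "f \<in> surjections A {..<k}" "g \<in> {..<k} \<rightarrow>\<^sub>E UNIV"
    "R = layered_rel A f g"
proof -
  have t: "(x, z) \<in> R" if "(x, y) \<in> R" "(y, z) \<in> R" for x y z
    using R(2) that by (rule transD)
  have ct: "(x, z) \<notin> R" if "(x, y) \<notin> R" "(y, z) \<notin> R" "x \<in> A" "y \<in> A" "z \<in> A" for x y z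
    using transD[OF R(3), of x y z] that by auto
  define lt where "lt = (\<lambda>i j. (i, j) \<in> R \<and> (j, i) \<notin> R)"
  \<comment> \<open>Negative transitivity: if both alternatives failed, transitivity of
    \<open>R\<close> or of its complement would contradict \<open>lt i j\<close> in each of four
    cases.\<close>
  have neg: "lt i m \<or> lt m j" if "lt i j" "i \<in> A" "j \<in> A" "m \<in> A" for i j m
    using that t ct unfolding lt_def by metis
  define L where "L = (\<lambda>i. {j \<in> A. lt j i})"
  have finL: "finite (L i)" for i using fin by (simp add: L_def)
  have less_iff: "card (L i) < card (L j) \<longleftrightarrow> lt i j" if ij: "i \<in> A" "j \<in> A" for i j
  proof
    assume "lt i j"
    have "L i \<subseteq> L j" using neg[of _ i j] ij \<open>lt i j\<close> unfolding L_def lt_def by blast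
    moreover have "i \<in> L j" "i \<notin> L i" using ij \<open>lt i j\<close> by (auto simp: L_def lt_def)
    ultimately show "card (L i) < card (L j)" by (intro psubset_card_mono finL) auto
  next
    assume *: "card (L i) < card (L j)"
    show "lt i j"
    proof (rule ccontr)
      assume "\<not> lt i j"
      then have "L j \<subseteq> L i" using neg[of _ j i] ij unfolding L_def by blast
      then have "card (L j) \<le> card (L i)" by (intro card_mono finL)
      with * show False by simp
    qed
  qed
  obtain k and f :: "'a \<Rightarrow> nat" where f: "f \<in> surjections A {..<k}"
    and f_less: "\<And>x y. x \<in> A \<Longrightarrow> y \<in> A \<Longrightarrow> f x < f y \<longleftrightarrow> card (L x) < card (L y)"
    by (rule surjections_lessThan_of_weak_order[OF fin, of "\<lambda>x. card (L x)"]) (rule that)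
  have f_lt: "f x < f y \<longleftrightarrow> lt x y" if "x \<in> A" "y \<in> A" for x y
    using f_less less_iff that by simp
  \<comment> \<open>Neither point strictly precedes the other, so \<open>(x, y)\<close> and
    \<open>(y, x)\<close> are both in \<open>R\<close>, which yields the loop, or both outside,
    which excludes it.\<close>
  have same: "(x, y) \<in> R \<longleftrightarrow> (x, x) \<in> R" if "x \<in> A" "y \<in> A" "f x = f y" for x y
  proof -
    have "\<not> lt x y" "\<not> lt y x" using f_lt that by (metis less_irrefl)+
    then show ?thesis using t ct that unfolding lt_def by metis
  qed
  have same': "(y, y) \<in> R \<longleftrightarrow> (x, x) \<in> R" if "x \<in> A" "y \<in> A" "f x = f y" for x y
  proof -
    have "\<not> lt x y" "\<not> lt y x" using f_lt that by (metis less_irrefl)+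
    then show ?thesis using same[OF that] same[OF that(2,1) that(3)[symmetric]]
      unfolding lt_def by metis
  qed
  \<comment> \<open>By \<open>same'\<close> one loop of rank \<open>m\<close> in \<open>R\<close>
    means all loops of that rank, so the existential loses nothing.\<close>
  define g where "g = restrict (\<lambda>m. \<exists>x\<in>A. f x = m \<and> (x, x) \<in> R) {..<k}"
  have g: "g (f x) \<longleftrightarrow> (x, x) \<in> R" if "x \<in> A" for x
  proof -
    have "f x < k" using f that by (auto simp: surjections_def)
    then have "g (f x) \<longleftrightarrow> (\<exists>y\<in>A. f y = f x \<and> (y, y) \<in> R)" by (simp add: g_def)
    then show ?thesis using that same' by metis
  qed
  have "(x, y) \<in> R \<longleftrightarrow> (x, y) \<in> layered_rel A f g" if xy: "x \<in> A" "y \<in> A" for x y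
  proof (cases "f x" "f y" rule: linorder_cases)
    case less
    then show ?thesis using xy f_lt[of x y] by (auto simp: layered_rel_def lt_def)
  next
    case equal
    then show ?thesis using xy same[of x y] g[of x] by (auto simp: layered_rel_def)
  next
    case greater
    then show ?thesis using xy f_lt[of y x] by (auto simp: layered_rel_def lt_def)
  qed
  moreover have "layered_rel A f g \<subseteq> A \<times> A" by (auto simp: layered_rel_def)
  ultimately have eq: "R = layered_rel A f g" using R(1) by auto
  show thesis by (rule that[OF f _ eq]) (simp add: g_def)
qed

text \<open>The relations correspond bijectively to triples of a number \<open>k\<close> of blocks,
  a surjective ranking onto \<open>{..<k}\<close> and a Boolean for each rank; the summand counts
  these for fixed \<open>k\<close>.\<close>

lemma card_bitransitive_relations:
  fixes A :: "'a set"
  assumes fin: "finite A" and "A \<noteq> {}"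
  shows "card {R. R \<subseteq> A \<times> A \<and> trans R \<and> trans (A \<times> A - R)} =
    (\<Sum>k = 1..card A. Stirling (card A) k * 2 ^ k * fact k)"
proof -
  define D where "D = (SIGMA k:{1..card A}. surjections A {..<k} \<times> ({..<k} \<rightarrow>\<^sub>E (UNIV :: bool set)))"
  define \<Phi> where "\<Phi> = (\<lambda>(k :: nat, f, g). layered_rel A f g)"
  have inj: "inj_on \<Phi> D"
  proof (rule inj_onI)
    fix u v assume uv: "u \<in> D" "v \<in> D" "\<Phi> u = \<Phi> v"
    obtain k f g k' f' g' where split: "u = (k, f, g)" "v = (k', f', g')"
      by (metis prod_cases3)
    from uv have D: "(k, f, g) \<in> D" "(k', f', g') \<in> D"
      and eq: "layered_rel A f g = layered_rel A f' g'" by (simp_all add: split \<Phi>_def)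
    \<comment> \<open>The strict order of the ranks is the asymmetric part of the relation. So the
      relation determines \<open>f\<close>, and its loops then determine \<open>g\<close>.\<close>
    have lt: "p x < p y \<longleftrightarrow> (x, y) \<in> layered_rel A p r \<and> (y, x) \<notin> layered_rel A p r"
      if "x \<in> A" "y \<in> A" for x y and p :: "'a \<Rightarrow> nat" and r
      using that by (auto simp: layered_rel_def)
    have f: "f \<in> surjections A {..<k}" "f' \<in> surjections A {..<k'}" using D by (auto simp: D_def)
    have iff: "f x < f y \<longleftrightarrow> f' x < f' y" if "x \<in> A" "y \<in> A" for x y
      using lt[OF that, of f g] lt[OF that, of f' g'] eq by simp
    note kf = surjections_lessThan_unique[OF f iff]
    have "g = g'"
    proof (rule extensionalityI[of _ "{..<k}"])
      fix m assume "m \<in> {..<k}"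
      then have "m \<in> f ` A" using f by (auto simp: surjections_def)
      then obtain x where "x \<in> A" "m = f x" by auto
      then have "g m \<longleftrightarrow> (x, x) \<in> layered_rel A f g" "g' m \<longleftrightarrow> (x, x) \<in> layered_rel A f' g'"
        using kf(2) by (auto simp: layered_rel_def)
      with eq show "g m = g' m" by simp
    qed (use D kf(1) in \<open>auto simp: D_def PiE_def\<close>)
    with kf show "u = v" by (simp add: split)
  qed
  have "{R. R \<subseteq> A \<times> A \<and> trans R \<and> trans (A \<times> A - R)} = \<Phi> ` D"
  proof (intro set_eqI iffI)
    fix R assume "R \<in> {R. R \<subseteq> A \<times> A \<and> trans R \<and> trans (A \<times> A - R)}"
    then have R: "R \<subseteq> A \<times> A" "trans R" "trans (A \<times> A - R)" by auto
    obtain f k g where kfg: "f \<in> surjections A {..<k}" "g \<in> {..<k} \<rightarrow>\<^sub>E UNIV"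
        "R = layered_rel A f g"
      by (rule layered_rel_exists[OF fin R])
    then have "f ` A = {..<k}" by (simp add: surjections_def)
    with fin have "k \<le> card A" "k \<noteq> 0" using card_image_le[of A f] assms by auto
    with kfg have "(k, f, g) \<in> D" by (auto simp: D_def)
    moreover have "R = \<Phi> (k, f, g)" using kfg by (simp add: \<Phi>_def)
    ultimately show "R \<in> \<Phi> ` D" by blast
  next
    fix R assume "R \<in> \<Phi> ` D"
    then obtain f g where "R = layered_rel A f g" by (auto simp: \<Phi>_def)
    then show "R \<in> {R. R \<subseteq> A \<times> A \<and> trans R \<and> trans (A \<times> A - R)}"
      using trans_layered_rel by (auto simp: layered_rel_def)
  qed
  then have "card {R. R \<subseteq> A \<times> A \<and> trans R \<and> trans (A \<times> A - R)} = card D"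
    by (simp add: card_image[OF inj])
  also have "\<dots> = (\<Sum>k = 1..card A. Stirling (card A) k * 2 ^ k * fact k)"
    unfolding D_def using fin
    by (subst card_SigmaI)
      (auto simp: finite_surjections card_surjections card_cartesian_product card_PiE
        finite_PiE intro!: sum.cong)
  finally show ?thesis .
qed

section \<open>Induced partitions with two parts\<close>

lemma B_eq_card:
  assumes "n \<ge> 1"
  shows "B n = card {R. R \<subseteq> complete_edges n \<and> trans R \<and> trans (complete_edges n - R)}"
  using card_bitransitive_relations[of "{1..n}"] assms by (simp add: B_def complete_edges_def)

text \<open>The induced partitions, as sets of relations, split the bitransitive relations other
  than the empty and the full one into pairs. The additive form avoids division and subtraction on
  naturals.\<close>

lemma graph_Stirling_2:
  assumes n: "n \<ge> 1"
  shows "2 * graph_Stirling n 2 + 2 = B n"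
proof -
  let ?E = "complete_edges n"
  define \<T> where "\<T> = {R. R \<subseteq> ?E \<and> trans R \<and> trans (?E - R)}"
  define \<P> where "\<P> = {P. partition_on ?E P \<and> card P = 2 \<and>
    (\<exists>c \<in> ?E \<rightarrow> {1..2::nat}. transitive_map n c \<and> P = induced_partition ?E c)}"
  have E: "finite ?E" "?E \<noteq> {}" using n by (auto simp: complete_edges_def)
  have finT: "finite \<T>" unfolding \<T>_def by (rule finite_subset[of _ "Pow ?E"]) (auto simp: E)
  have two: "\<exists>R\<in>\<T> - {{}, ?E}. P = {R, ?E - R}" if P: "P \<in> \<P>" for P
  proof -
    from P obtain c where c: "c \<in> ?E \<rightarrow> {1..2::nat}" "transitive_map n c"
      "P = induced_partition ?E c" "card P = 2" by (auto simp: \<P>_def)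
    have "{1..2} = {1, 2::nat}" by auto
    then have sub: "c ` ?E \<subseteq> {1, 2}" using c(1) by auto
    have "card (c ` ?E) = 2" using c by (simp add: card_induced_partition)
    then have img: "c ` ?E = {1, 2}" using sub by (intro card_subset_eq) auto
    define R where "R = {e \<in> ?E. c e = 1}"
    have co: "?E - R = {e \<in> ?E. c e = 2}" using sub by (auto simp: R_def)
    have "P = {{e \<in> ?E. c e = 1}, {e \<in> ?E. c e = 2}}"
      unfolding c(3) induced_partition_def img by simp
    then have P_eq: "P = {R, ?E - R}" unfolding co by (simp only: R_def)
    have tr: "trans {e \<in> ?E. c e = t}" for t
    proof (rule transI)
      fix i j k assume "(i, j) \<in> {e \<in> ?E. c e = t}" "(j, k) \<in> {e \<in> ?E. c e = t}"
      then have *: "i \<in> {1..n}" "j \<in> {1..n}" "k \<in> {1..n}" "c (i, j) = t" "c (j, k) = t"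
        by (auto simp: complete_edges_def)
      then have "c (i, k) = t" using c(2) unfolding transitive_map_def by (metis insertE singletonD)
      then show "(i, k) \<in> {e \<in> ?E. c e = t}" using * by (auto simp: complete_edges_def)
    qed
    have "trans R" unfolding R_def by (rule tr)
    moreover have "trans (?E - R)" unfolding co by (rule tr)
    moreover have "R \<subseteq> ?E" by (auto simp: R_def)
    ultimately have "R \<in> \<T>" by (simp add: \<T>_def)
    moreover have "1 \<in> c ` ?E" "2 \<in> c ` ?E" using img by auto
    then obtain e e' where "e \<in> ?E" "c e = 1" "e' \<in> ?E" "c e' = 2" by (metis imageE)
    then have "e \<in> R" "e' \<in> ?E - R" by (auto simp: R_def)
    then have "R \<noteq> {}" "R \<noteq> ?E" by auto
    ultimately show ?thesis using P_eq by auto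
  qed
  have pair: "{R, ?E - R} \<in> \<P>" if R: "R \<in> \<T> - {{}, ?E}" for R
  proof -
    define c where "c = (\<lambda>e. if e \<in> R then 1 else 2::nat)"
    have R': "R \<subseteq> ?E" "trans R" "trans (?E - R)" "R \<noteq> {}" "R \<noteq> ?E" using R by (auto simp: \<T>_def)
    have "c ` ?E = {1, 2}" using R' by (auto simp: c_def)
    then have ind: "induced_partition ?E c = {R, ?E - R}"
      using R'(1) by (auto simp: induced_partition_def c_def)
    have "transitive_map n c" unfolding transitive_map_def
    proof (intro ballI)
      \<comment> \<open>If \<open>(i, j)\<close> and \<open>(j, k)\<close> share a colour,
        transitivity of \<open>R\<close> or of its complement passes it on to \<open>(i, k)\<close>;
        otherwise both colours are allowed.\<close>
      fix i j k assume "i \<in> {1..n}" "j \<in> {1..n}" "k \<in> {1..n}"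
      then show "c (i, k) \<in> {c (i, j), c (j, k)}"
        using transD[OF R'(2), of i j k] transD[OF R'(3), of i j k]
        by (auto simp: c_def complete_edges_def)
    qed
    moreover have "card {R, ?E - R} = 2" using R' by (auto simp: card_insert_if)
    moreover have "c \<in> ?E \<rightarrow> {1..2}" by (auto simp: c_def)
    ultimately show ?thesis
      using partition_on_induced_partition[of ?E c] ind[symmetric] by (auto simp: \<P>_def)
  qed
  have co: "?E - R \<in> \<T> - {{}, ?E}" if "R \<in> \<T> - {{}, ?E}" for R
    using that by (auto simp: \<T>_def double_diff)
  have Un: "\<Union>\<P> = \<T> - {{}, ?E}" using two pair co by blast
  \<comment> \<open>Either part determines the partition, so different partitions share no
    part.\<close>
  have eq: "P = {R, ?E - R}" if "P \<in> \<P>" "R \<in> P" for P R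
    using two[OF that(1)] that(2) by (auto simp: \<T>_def double_diff)
  have "2 * card \<P> = card (\<Union>\<P>)"
  proof (rule card_partition)
    have "\<P> \<subseteq> Pow (\<T> - {{}, ?E})" using Un by auto
    then show "finite \<P>" using finT by (meson finite_Diff finite_Pow_iff finite_subset)
    show "finite (\<Union>\<P>)" using Un finT by simp
    show "\<And>P. P \<in> \<P> \<Longrightarrow> card P = 2" by (simp add: \<P>_def)
    show "\<And>P P'. P \<in> \<P> \<Longrightarrow> P' \<in> \<P> \<Longrightarrow> P \<noteq> P' \<Longrightarrow> P \<inter> P' = {}" using eq by blast
  qed
  also have "\<dots> + 2 = card \<T>"
  proof -
    have "trans ?E" by (auto simp: complete_edges_def trans_def)
    \<comment> \<open>These are the two bitransitive relations whose pair would contain an empty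
      part; they differ because \<open>?E\<close> is nonempty.\<close>
    then have sub: "{{}, ?E} \<subseteq> \<T>" by (auto simp: \<T>_def)
    have "card {{}, ?E} = 2" using E(2) by (auto simp: card_insert_if)
    moreover have "card {{}, ?E} \<le> card \<T>" by (rule card_mono[OF finT sub])
    ultimately show ?thesis unfolding Un using card_Diff_subset[OF _ sub] by simp
  qed
  finally show ?thesis
    using B_eq_card[OF n] by (simp add: graph_Stirling_def \<P>_def \<T>_def)
qed

theorem proposition3p14:
  fixes n k :: nat
  assumes "n \<ge> 1" and "k \<ge> 1"
  shows "(k \<ge> 3 \<longrightarrow> graph_Stirling n k = 2 * Stirling n k) \<and>
         (k = 2 \<longrightarrow> real (graph_Stirling n k) = 1 / 2 * real (B n) - 1) \<and>
         B n = card {R. R \<subseteq> complete_edges n \<and> trans R \<and> trans (complete_edges n - R)}"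
proof (intro conjI impI)
  assume "k = 2"
  with graph_Stirling_2[OF assms(1)] show "real (graph_Stirling n k) = 1 / 2 * real (B n) - 1"
    by auto
qed (use assms in \<open>simp_all add: graph_Stirling_ge_3 B_eq_card\<close>)

end
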